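(* Let $\mathbb{F}$ be a field, $E=\mathbb{F}^n$, and let $\mathcal{I}$ be the family of independent spaces of a $q$-matroid with ground space $E$. Then $(E,\mathcal{I})$ is a $q$-$\Delta$-matroid.
   Context: $E=\mathbb{F}^n$ is a finite-dimensional vector space over a field $\mathbb{F}$. A $q$-matroid on $E$ is a pair $M=(E,r)$ with $r$ an integer-valued function on the subspaces of $E$ such that (R1) $0\le r(A)\le\dim A$ for every subspace $A$; (R2) $r(A)\le r(B)$ whenever $A\subseteq B$; (R3) $r(A+B)+r(A\cap B)\le r(A)+r(B)$ for all subspaces $A,B$. A subspace $A$ is independent if $r(A)=\dim A$. A $q$-$\Delta$-matroid is a pair $(E,\mathcal{F})$ with $\mathcal{F}$ a non-empty family of subspaces of $E$ satisfying: (F1) For all $X,Y\in\mathcal{F}$ and each subspace $A$ of codimension $1$ in $X$, either (i) there is a codimension-$1$ subspace $Z\subseteq E$ with $A\subseteq Z$, $Y\not\subseteq Z$, such that $A+z\in\mathcal{F}$ for all $1$-dimensional $z\subseteq E$ with $z\not\subseteq Z$; or (ii) there is a codimension-$1$ subspace $Z\subseteq E$ such that $Z\cap A\in\mathcal{F}$. (F2) For all $X,Y\in\mathcal{F}$ and each subspace $A\subseteq E$ in which $X$ has codimension $1$, either (iii) there is a $1$-dimensional $z\subseteq A$, $z\not\subseteq Y$, such that $A\cap Z\in\mathcal{F}$ for every codimension-$1$ subspace $Z\subseteq E$ with $z\not\subseteq Z$; or (iv) there is a $1$-dimensional $z\subseteq E$ such that $A+z\in\mathcal{F}$. *)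

theory Defs
  imports "HOL-Analysis.Cartesian_Space" "HOL-Library.Set_Algebras"
begin

text \<open>
  The ground space \<open>E\<close> is a linear subspace of a coordinate space \<open>'f ^ 'm\<close>. The space
  \<open>F^n\<close> for \<open>n > 0\<close> is \<open>E = UNIV\<close> with \<open>CARD('m) = n\<close>; index types are never empty,
  so the zero-dimensional space only appears as \<open>E = {0}\<close>. The sum \<open>A + B\<close> of two subspaces
  is the elementwise sum of sets.
\<close>

definition subspace_of :: "('f::field ^ 'm) set \<Rightarrow> ('f ^ 'm) set \<Rightarrow> bool" where
  "subspace_of A E \<longleftrightarrow> vec.subspace A \<and> A \<subseteq> E"

definition codim1_in :: "('f::field ^ 'm) set \<Rightarrow> ('f ^ 'm) set \<Rightarrow> bool" where
  "codim1_in A X \<longleftrightarrow> subspace_of A X \<and> vec.dim X = vec.dim A + 1"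

definition line_in :: "('f::field ^ 'm) set \<Rightarrow> ('f ^ 'm) set \<Rightarrow> bool" where
  "line_in z X \<longleftrightarrow> subspace_of z X \<and> vec.dim z = 1"

text \<open>The values of \<open>r\<close> on sets that are not subspaces of \<open>E\<close> are irrelevant.\<close>

definition q_matroid :: "('f::field ^ 'm) set \<Rightarrow> (('f ^ 'm) set \<Rightarrow> int) \<Rightarrow> bool" where
  "q_matroid E r \<longleftrightarrow>
     vec.subspace E \<and>
     (\<forall>A. subspace_of A E \<longrightarrow> 0 \<le> r A \<and> r A \<le> int (vec.dim A)) \<and>
     (\<forall>A B. subspace_of A E \<and> subspace_of B E \<and> A \<subseteq> B \<longrightarrow> r A \<le> r B) \<and>
     (\<forall>A B. subspace_of A E \<and> subspace_of B E \<longrightarrow> r (A + B) + r (A \<inter> B) \<le> r A + r B)"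

definition independent_spaces ::
    "('f::field ^ 'm) set \<Rightarrow> (('f ^ 'm) set \<Rightarrow> int) \<Rightarrow> ('f ^ 'm) set set" where
  "independent_spaces E r = {A. subspace_of A E \<and> r A = int (vec.dim A)}"

definition delta_F1 :: "('f::field ^ 'm) set \<Rightarrow> ('f ^ 'm) set set \<Rightarrow> bool" where
  "delta_F1 E \<F> \<longleftrightarrow>
     (\<forall>X\<in>\<F>. \<forall>Y\<in>\<F>. \<forall>A. codim1_in A X \<longrightarrow>
        (\<exists>Z. codim1_in Z E \<and> A \<subseteq> Z \<and> \<not> Y \<subseteq> Z \<and>
             (\<forall>z. line_in z E \<and> \<not> z \<subseteq> Z \<longrightarrow> A + z \<in> \<F>)) \<or>
        (\<exists>Z. codim1_in Z E \<and> Z \<inter> A \<in> \<F>))"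

definition delta_F2 :: "('f::field ^ 'm) set \<Rightarrow> ('f ^ 'm) set set \<Rightarrow> bool" where
  "delta_F2 E \<F> \<longleftrightarrow>
     (\<forall>X\<in>\<F>. \<forall>Y\<in>\<F>. \<forall>A. subspace_of A E \<and> codim1_in X A \<longrightarrow>
        (\<exists>z. line_in z A \<and> \<not> z \<subseteq> Y \<and>
             (\<forall>Z. codim1_in Z E \<and> \<not> z \<subseteq> Z \<longrightarrow> A \<inter> Z \<in> \<F>)) \<or>
        (\<exists>z. line_in z E \<and> A + z \<in> \<F>))"

definition q_delta_matroid :: "('f::field ^ 'm) set \<Rightarrow> ('f ^ 'm) set set \<Rightarrow> bool" where
  "q_delta_matroid E \<F> \<longleftrightarrow>
     vec.subspace E \<and> \<F> \<noteq> {} \<and> (\<forall>X\<in>\<F>. subspace_of X E) \<and> delta_F1 E \<F> \<and> delta_F2 E \<F>"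

end

(*
  The nullity dim A - r A is monotone and supermodular, and the independent spaces are those of
  nullity 0. In particular subspaces of independent spaces are independent, which makes (F1)(ii)
  hold for every hyperplane Z, and (F2)(iv) hold with z inside A whenever A is independent.
  Otherwise A contains an independent space of codimension 1, so A has nullity 1; by
  supermodularity the dependent subspaces of A are closed under intersection, so there is a least
  one, C. Since C is dependent it is not contained in Y, and any line z of C outside Y satisfies
  (F2)(iii): if Z does not contain z, then the intersection of A and Z does not contain C.
*)
theory Submission imports Defs begin

section \<open>Sums, complements and lines of subspaces\<close>

lemma subspace_set_plus:
  fixes A B :: "('f::field ^ 'm) set"
  assumes "vec.subspace A" "vec.subspace B"
  shows "vec.subspace (A + B)"
proof -
  have "A + B = {x + y |x y. x \<in> A \<and> y \<in> B}"
    by (auto simp: set_plus_def)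
  then show ?thesis
    using vec.subspace_sums[OF assms] by simp
qed

lemma dim_set_plus_Int:
  fixes A B :: "('f::field ^ 'm) set"
  assumes "vec.subspace A" "vec.subspace B"
  shows "vec.dim (A + B) + vec.dim (A \<inter> B) = vec.dim A + vec.dim B"
proof -
  have "A + B = {x + y |x y. x \<in> A \<and> y \<in> B}"
    by (auto simp: set_plus_def)
  then show ?thesis
    using vec.dim_sums_Int[OF assms] by simp
qed

lemma set_plus_subset_subspace:
  fixes A B S :: "('f::field ^ 'm) set"
  assumes "vec.subspace S" "A \<subseteq> S" "B \<subseteq> S"
  shows "A + B \<subseteq> S"
  using assms vec.subspace_add by (fastforce elim!: set_plus_elim)

text \<open>A basis \<open>K\<close> of \<open>B\<close> extends to a basis \<open>L\<close> of
  \<open>A\<close>, and the added vectors span a complement. It serves to bound the rank growth from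
  \<open>B\<close> to \<open>A\<close> by the dimension growth.\<close>

lemma complement_exists:
  fixes A B :: "('f::field ^ 'm) set"
  assumes "vec.subspace A" "vec.subspace B" "B \<subseteq> A"
  obtains W where "vec.subspace W" "B + W = A" "vec.dim A = vec.dim B + vec.dim W"
proof -
  obtain K where K: "K \<subseteq> B" "vec.independent K" "B \<subseteq> vec.span K"
    using vec.maximal_independent_subset by blast
  obtain L where L: "K \<subseteq> L" "L \<subseteq> A" "vec.independent L" "A \<subseteq> vec.span L"
    using vec.maximal_independent_subset_extend[of K A] K assms(3) by blast
  let ?W = "vec.span (L - K)"
  have spans: "vec.span K = B" "vec.span L = A"
    using K L assms by (metis vec.span_subspace)+
  have "B + ?W = A"
    using vec.span_Un[of K "L - K"] spans \<open>K \<subseteq> L\<close>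
    by (auto simp: set_plus_def Un_absorb1)
  moreover have "vec.dim A = vec.dim B + vec.dim ?W"
  proof -
    have "card L = card K + card (L - K)"
      using \<open>K \<subseteq> L\<close> vec.finiteI_independent[OF \<open>vec.independent L\<close>]
      by (metis card_Diff_subset card_mono finite_subset le_add_diff_inverse)
    moreover have "vec.independent (L - K)"
      using \<open>vec.independent L\<close> vec.independent_mono by blast
    ultimately show ?thesis
      using spans K(2) L(3) vec.dim_span_eq_card_independent by metis
  qed
  ultimately show thesis
    using that by blast
qed

lemma subspace_of_dim_exists:
  fixes S :: "('f::field ^ 'm) set"
  assumes "vec.subspace S" "n \<le> vec.dim S"
  obtains T where "subspace_of T S" "vec.dim T = n"
  using vec.choose_subspace_of_subspace[OF assms(2)] vec.span_eq_iff assms(1)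
  unfolding subspace_of_def by metis

lemma line_in_not_subset_exists:
  fixes C Y :: "('f::field ^ 'm) set"
  assumes "vec.subspace C" "vec.subspace Y" "\<not> C \<subseteq> Y"
  obtains z where "line_in z C" "\<not> z \<subseteq> Y"
proof -
  obtain v where v: "v \<in> C" "v \<notin> Y"
    using assms(3) by blast
  then have "v \<noteq> 0"
    using vec.subspace_0[OF assms(2)] by auto
  then have "vec.dim (vec.span {v}) = 1"
    by simp
  then have "line_in (vec.span {v}) C"
    using v assms(1) by (simp add: line_in_def subspace_of_def vec.span_minimal)
  moreover have "\<not> vec.span {v} \<subseteq> Y"
    using v vec.span_base by blast
  ultimately show thesis
    using that by blast
qed

section \<open>Nullity and the independent spaces of a q-matroid\<close>

definition nullity :: "(('f::field ^ 'm) set \<Rightarrow> int) \<Rightarrow> ('f ^ 'm) set \<Rightarrow> int" where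
  "nullity r A = int (vec.dim A) - r A"

lemma independent_spaces_iff_nullity:
  "A \<in> independent_spaces E r \<longleftrightarrow> subspace_of A E \<and> nullity r A = 0"
  by (auto simp: independent_spaces_def nullity_def)

lemma subspace_of_trans: "subspace_of A B \<Longrightarrow> subspace_of B C \<Longrightarrow> subspace_of A C"
  by (auto simp: subspace_of_def)

lemma subspace_of_Int: "subspace_of A E \<Longrightarrow> subspace_of B E \<Longrightarrow> subspace_of (A \<inter> B) E"
  by (auto simp: subspace_of_def vec.subspace_inter)

context
  fixes E :: "('f::field ^ 'm) set" and r :: "('f ^ 'm) set \<Rightarrow> int"
  assumes M: "q_matroid E r"
begin

lemma subspace_ground: "vec.subspace E"
  using M by (simp add: q_matroid_def)

lemma rank_nonneg: "subspace_of A E \<Longrightarrow> 0 \<le> r A"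
  and rank_le_dim: "subspace_of A E \<Longrightarrow> r A \<le> int (vec.dim A)"
  and rank_mono: "subspace_of A E \<Longrightarrow> subspace_of B E \<Longrightarrow> A \<subseteq> B \<Longrightarrow> r A \<le> r B"
  and rank_submodular:
    "subspace_of A E \<Longrightarrow> subspace_of B E \<Longrightarrow> r (A + B) + r (A \<inter> B) \<le> r A + r B"
  using M unfolding q_matroid_def by blast+

lemma nullity_nonneg: "subspace_of A E \<Longrightarrow> 0 \<le> nullity r A"
  using rank_le_dim by (simp add: nullity_def)

text \<open>Dimension is modular on subspaces, so subtracting the submodular \<open>r\<close>
  reverses the inequality.\<close>

lemma nullity_supermodular:
  assumes "subspace_of A E" "subspace_of B E"
  shows "nullity r A + nullity r B \<le> nullity r (A + B) + nullity r (A \<inter> B)"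
  using rank_submodular[OF assms] dim_set_plus_Int[of A B] assms
  unfolding nullity_def subspace_of_def by linarith

text \<open>For a complement \<open>W\<close> of \<open>B\<close> in \<open>A\<close>, submodularity
  and \<open>r (B \<inter> W) \<ge> 0\<close> give \<open>r A \<le> r B + r W\<close>, and
  \<open>r W\<close> is at most \<open>vec.dim W\<close>, the growth in dimension.\<close>

lemma nullity_mono:
  assumes "subspace_of B A" "subspace_of A E"
  shows "nullity r B \<le> nullity r A"
proof -
  have A: "vec.subspace A" "A \<subseteq> E" and B: "vec.subspace B" "B \<subseteq> A"
    using assms by (auto simp: subspace_of_def)
  obtain W where W: "vec.subspace W" "B + W = A" "vec.dim A = vec.dim B + vec.dim W"
    using complement_exists A(1) B by blast
  have "W \<subseteq> A"
    using W(2) vec.subspace_0[OF B(1)] by (metis add_0 set_plus_intro subsetI)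
  then have W_E: "subspace_of W E" and B_E: "subspace_of B E"
    using W(1) A B by (auto simp: subspace_of_def)
  have "r A \<le> r B + r W"
    using rank_submodular[OF B_E W_E] rank_nonneg[OF subspace_of_Int[OF B_E W_E]] W(2) by simp
  with rank_le_dim[OF W_E] W(3) show ?thesis
    by (simp add: nullity_def)
qed

text \<open>The nullity of \<open>B\<close> is squeezed between 0 and that of \<open>A\<close>,
  which is 0.\<close>

lemma independent_spaces_hereditary:
  assumes "A \<in> independent_spaces E r" "subspace_of B A"
  shows "B \<in> independent_spaces E r"
  using assms nullity_mono[of B A] nullity_nonneg[of B] subspace_of_trans[of B A E]
  by (auto simp: independent_spaces_iff_nullity)

lemma zero_independent: "{0} \<in> independent_spaces E r"
proof -
  have "subspace_of {0} E"
    using vec.subspace_0[OF subspace_ground] by (simp add: subspace_of_def)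
  moreover have "r {0} = 0"
    using rank_nonneg[OF calculation] rank_le_dim[OF calculation] by simp
  ultimately show ?thesis
    by (simp add: independent_spaces_def)
qed

text \<open>This is the q-analogue of a set of nullity 1 containing a unique circuit.\<close>

lemma least_dependent_subspace:
  assumes A: "subspace_of A E" "nullity r A = 1"
  obtains C where "subspace_of C A" "C \<notin> independent_spaces E r"
    "\<And>D. subspace_of D A \<Longrightarrow> D \<notin> independent_spaces E r \<Longrightarrow> C \<subseteq> D"
proof -
  define \<D> where "\<D> = {D. subspace_of D A \<and> nullity r D = 1}"
  have sub: "subspace_of D E" if "subspace_of D A" for D
    using that A(1) subspace_of_trans by blast
  \<comment> \<open>By monotonicity the integer nullity of \<open>D\<close> is 0 or 1, so dependence
    is the equation that defines \<open>\<D>\<close>.\<close>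
  have dependent_iff: "D \<notin> independent_spaces E r \<longleftrightarrow> D \<in> \<D>" if "subspace_of D A" for D
    using that A(2) sub[OF that] nullity_nonneg[OF sub[OF that]] nullity_mono[OF that A(1)]
    by (auto simp: independent_spaces_iff_nullity \<D>_def)
  have Int: "C \<inter> D \<in> \<D>" if "C \<in> \<D>" "D \<in> \<D>" for C D
  proof -
    have CD: "subspace_of C A" "subspace_of D A" "nullity r C = 1" "nullity r D = 1"
      using that by (auto simp: \<D>_def)
    have "subspace_of (C + D) A"
      using CD(1,2) A(1) subspace_set_plus[of C D] set_plus_subset_subspace[of A C D]
      by (simp add: subspace_of_def)
    then have "nullity r (C + D) \<le> 1"
      using nullity_mono A by metis
    moreover have I: "subspace_of (C \<inter> D) A"
      using subspace_of_Int CD by blast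
    moreover have "nullity r (C \<inter> D) \<le> 1"
      using nullity_mono[OF I A(1)] A(2) by simp
    \<comment> \<open>Supermodularity bounds the nullities of \<open>C + D\<close> and
      \<open>C \<inter> D\<close> below by 2 in total; each is at most 1, so both equal 1.\<close>
    ultimately show ?thesis
      using nullity_supermodular[OF sub[OF CD(1)] sub[OF CD(2)]] CD(3,4)
      by (simp add: \<D>_def)
  qed
  have "A \<in> \<D>"
    using A by (simp add: \<D>_def subspace_of_def)
  then obtain C where C: "C \<in> \<D>" "\<And>D. D \<in> \<D> \<Longrightarrow> vec.dim C \<le> vec.dim D"
    using exists_least_iff[of "\<lambda>n. \<exists>D\<in>\<D>. vec.dim D = n"] by (metis linorder_not_less)
  have "C \<subseteq> D" if "D \<in> \<D>" for D
  proof -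
    \<comment> \<open>Closure under intersection turns least dimension into least for inclusion:
      \<open>C \<inter> D\<close> lies in \<open>\<D>\<close>, so its dimension cannot drop below
      that of \<open>C\<close>.\<close>
    have "C \<inter> D = C"
      using C(2)[OF Int[OF C(1) that]] Int[OF C(1) that] C(1)
      by (intro vec.subspace_dim_equal) (auto simp: \<D>_def subspace_of_def)
    then show ?thesis
      by blast
  qed
  moreover have "subspace_of C A"
    using C(1) by (simp add: \<D>_def)
  ultimately show thesis
    using that C(1) dependent_iff by blast
qed

section \<open>The two axioms of a q-Delta-matroid\<close>

lemma independent_spaces_delta_F1: "delta_F1 E (independent_spaces E r)"
  unfolding delta_F1_def
proof (intro ballI allI impI disjI2)
  fix X A
  assume X: "X \<in> independent_spaces E r" and A: "codim1_in A X"
  \<comment> \<open>Hence \<open>E\<close> is nonzero: it has a hyperplane, and the natural number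
    \<open>vec.dim E - 1\<close> is not truncated.\<close>
  have "vec.dim A + 1 \<le> vec.dim E"
    using X A vec.dim_subset[of X E]
    by (simp add: independent_spaces_def codim1_in_def subspace_of_def)
  then obtain Z where Z: "subspace_of Z E" "vec.dim Z = vec.dim E - 1" "vec.dim E \<ge> 1"
    using subspace_of_dim_exists[OF subspace_ground, of "vec.dim E - 1"] by auto
  have "subspace_of (Z \<inter> A) X"
    using Z(1) A by (auto simp: codim1_in_def subspace_of_def vec.subspace_inter)
  then have "Z \<inter> A \<in> independent_spaces E r"
    using independent_spaces_hereditary X by blast
  then show "\<exists>Z. codim1_in Z E \<and> Z \<inter> A \<in> independent_spaces E r"
    using Z by (auto simp: codim1_in_def)
qed

lemma independent_spaces_delta_F2: "delta_F2 E (independent_spaces E r)"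
  unfolding delta_F2_def
proof (intro ballI allI impI)
  fix X Y A
  assume X: "X \<in> independent_spaces E r" and Y: "Y \<in> independent_spaces E r"
    and "subspace_of A E \<and> codim1_in X A"
  then have A: "subspace_of A E" and XA: "codim1_in X A"
    by auto
  show "(\<exists>z. line_in z A \<and> \<not> z \<subseteq> Y \<and>
          (\<forall>Z. codim1_in Z E \<and> \<not> z \<subseteq> Z \<longrightarrow> A \<inter> Z \<in> independent_spaces E r)) \<or>
        (\<exists>z. line_in z E \<and> A + z \<in> independent_spaces E r)"
  proof (cases "A \<in> independent_spaces E r")
    case True
    \<comment> \<open>Since \<open>X\<close> has codimension 1 in \<open>A\<close>, the dimension of
      \<open>A\<close> is at least 1. A line inside \<open>A\<close> leaves \<open>A + z\<close>
      equal to \<open>A\<close>.\<close>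
    obtain z where z: "subspace_of z A" "vec.dim z = 1"
      using subspace_of_dim_exists[of A 1] A XA by (auto simp: subspace_of_def codim1_in_def)
    have "A + z = A"
    proof
      show "A + z \<subseteq> A"
        using A z(1) set_plus_subset_subspace[of A A z] by (simp add: subspace_of_def)
      show "A \<subseteq> A + z"
        using z(1) vec.subspace_0[of z]
        by (metis add.right_neutral set_plus_intro subsetI subspace_of_def)
    qed
    then show ?thesis
      using True z A subspace_of_trans by (metis line_in_def)
  next
    case False
    \<comment> \<open>As \<open>r X\<close> equals \<open>vec.dim A - 1\<close>, this bounds the
      nullity of \<open>A\<close> by 1, while dependence makes it positive.\<close>
    have "r X \<le> r A"
      using rank_mono[of X A] X A XA by (auto simp: independent_spaces_def codim1_in_def subspace_of_def)
    then have "nullity r A = 1"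
      using X XA A False nullity_nonneg[OF A]
      by (auto simp: nullity_def independent_spaces_def codim1_in_def)
    then obtain C where C: "subspace_of C A" "C \<notin> independent_spaces E r"
      and least: "\<And>D. subspace_of D A \<Longrightarrow> D \<notin> independent_spaces E r \<Longrightarrow> C \<subseteq> D"
      using least_dependent_subspace[OF A] by blast
    have "\<not> C \<subseteq> Y"
      using C independent_spaces_hereditary[OF Y, of C] by (auto simp: subspace_of_def)
    then obtain z where z: "line_in z C" "\<not> z \<subseteq> Y"
      using line_in_not_subset_exists[of C Y] C(1) Y
      by (auto simp: subspace_of_def independent_spaces_def)
    have "A \<inter> Z \<in> independent_spaces E r" if "codim1_in Z E" "\<not> z \<subseteq> Z" for Z
    proof (rule ccontr)
      assume "A \<inter> Z \<notin> independent_spaces E r"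
      moreover have "subspace_of (A \<inter> Z) A"
        using A that(1) by (auto simp: subspace_of_def codim1_in_def vec.subspace_inter)
      ultimately have "C \<subseteq> Z"
        using least by blast
      with z(1) that(2) show False
        by (auto simp: line_in_def subspace_of_def)
    qed
    moreover have "line_in z A"
      using z(1) C(1) subspace_of_trans by (auto simp: line_in_def)
    ultimately show ?thesis
      using z(2) by blast
  qed
qed

end

theorem proposition3p4:
  fixes E :: "('f::field ^ 'm) set" and r :: "('f ^ 'm) set \<Rightarrow> int"
  assumes "q_matroid E r"
  shows "q_delta_matroid E (independent_spaces E r)"
  unfolding q_delta_matroid_def
  using subspace_ground[OF assms] zero_independent[OF assms]
    independent_spaces_delta_F1[OF assms] independent_spaces_delta_F2[OF assms]
  by (auto simp: independent_spaces_def)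

end
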